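(* Let $G=(V,E)$ be a $\mathbb{Z}^d$-gain graph with edge weight $\omega:E\to\mathbb{R}$. If $\dim\ker\mathcal{L}_{\mathbb{Z}^d}(G,\omega)=1$ and $\mathcal{L}_{\mathbb{Z}^d}(G,\omega)$ is positive semidefinite, then the optimization problem $(\mathrm{P}_{G,\omega})$: minimize $\mathcal{E}_{G,\omega}(p,L)$ over $(p,L)\in\mathcal{R}(G)$ subject to $\log|\det L|\ge 0$, has a KKT point $(p^*,L^* )$ which is unique up to isometries, and $(p^*,L^* )$ is a global minimizer of $(\mathrm{P}_{G,\omega})$.
   Context: Fix an integer $d\ge 1$. A $\mathbb{Z}^d$-gain graph $G=(V,E)$ consists of a finite nonempty vertex set $V$ and a finite set $E$ of edges, where an edge is an equivalence class of triples $(u,v,\gamma)\in V\times V\times\mathbb{Z}^d$ under the identification $(u,v,\gamma)\sim(v,u,-\gamma)$, and triples $(u,u,0)$ are not allowed. The edge is a loop if $u=v$. One representative of each edge is fixed; the notions below do not depend on this choice. $\mathcal{R}(G)$ is the space of all pairs $(p,L)$ with $p:V\to\mathbb{R}^d$ and $L\in\mathbb{R}^{d\times d}$. The energy function is $\mathcal{E}_{G,\omega}(p,L)=\frac12\sum_{e=(u,v,\gamma)\in E}\omega(e)\|p(v)+L\gamma-p(u)\|^2$. $I_{\mathbb{Z}^d}(G)$ is the $|E|\times(|V|+d)$ matrix whose row for $e=(u,v,\gamma)$ has $-1$ in column $u$, $+1$ in column $v$, $0$ in the other vertex columns (all vertex columns $0$ if $e$ is a loop), and $\gamma^\top$ in the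 last $d$ columns. $\mathcal{L}_{\mathbb{Z}^d}(G,\omega)=I_{\mathbb{Z}^d}(G)^\top\,\mathrm{diag}(\omega)\,I_{\mathbb{Z}^d}(G)$. KKT point: write the constraint in standard form as $g(p,L):=-\log|\det L|\le 0$. A point $(p,L)\in\mathcal{R}(G)$ with $L$ nonsingular is a KKT point of $(\mathrm{P}_{G,\omega})$ if there is a multiplier $\lambda\in\mathbb{R}$ with $\nabla\mathcal{E}_{G,\omega}(p,L)+\lambda\nabla g(p,L)=0$ (stationarity), $\lambda\, g(p,L)=0$ (complementary slackness), and $\lambda\ge 0$ (sign condition). "Unique up to isometries" means that for any two KKT points $(p,L)$ and $(p',L')$ there are an orthogonal $d\times d$ matrix $M$ and $x\in\mathbb{R}^d$ with $p'(v)=Mp(v)+x$ for all $v\in V$ and $L'=ML$. *)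

theory Defs
  imports "HOL-Analysis.Analysis"
begin

text \<open>
  The vertex set is the whole of a finite type \<open>'v\<close> and \<open>d\<close> is the cardinality of a finite
  type \<open>'d\<close>; both are automatically nonempty. Edges are kept as equivalence classes of
  triples, and the fixed choice of representatives is a function \<open>rep\<close> on edges.
\<close>

type_synonym ('v, 'd) triple = "'v \<times> 'v \<times> (int^'d)"
type_synonym ('v, 'd) edge = "('v, 'd) triple set"

definition flip_rel :: "(('v, 'd::finite) triple \<times> ('v, 'd) triple) set" where
  "flip_rel = {((u, v, \<gamma>), t). t = (u, v, \<gamma>) \<or> t = (v, u, - \<gamma>)}"

lemma equiv_flip_rel: "equiv UNIV flip_rel"
  by (rule equivI) (auto simp: flip_rel_def refl_on_def intro!: symI transI)

definition gain_graph :: "('v::finite, 'd::finite) edge set \<Rightarrow> bool" where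
  "gain_graph E \<longleftrightarrow> finite E \<and> E \<subseteq> (UNIV - {(u, u, 0) | u. True}) // flip_rel"

definition edge_reps :: "('v, 'd) edge set \<Rightarrow> (('v, 'd) edge \<Rightarrow> ('v, 'd) triple) \<Rightarrow> bool" where
  "edge_reps E rep \<longleftrightarrow> (\<forall>e\<in>E. rep e \<in> e)"

definition gain_vec :: "int^'d \<Rightarrow> real^'d" where
  "gain_vec \<gamma> = (\<chi> i. real_of_int (\<gamma> $ i))"

text \<open>
  The space of pairs \<open>(p, L)\<close>, as a Euclidean space; its inner product is the standard one
  on all entries of \<open>p\<close> and \<open>L\<close>, so \<open>GDERIV\<close> is the usual gradient.
\<close>

type_synonym ('v, 'd) realization = "((real^'d)^'v) \<times> (real^'d^'d)"

definition energy ::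
  "('v::finite, 'd::finite) edge set \<Rightarrow> (('v, 'd) edge \<Rightarrow> ('v, 'd) triple) \<Rightarrow>
   (('v, 'd) edge \<Rightarrow> real) \<Rightarrow> ('v, 'd) realization \<Rightarrow> real" where
  "energy E rep \<omega> = (\<lambda>(p, L).
     1/2 * (\<Sum>e\<in>E. case rep e of (u, v, \<gamma>) \<Rightarrow>
       \<omega> e * (norm (p $ v + L *v gain_vec \<gamma> - p $ u))\<^sup>2))"

text \<open>
  The rows of the incidence matrix are indexed by the set of edges, which is not a type, so
  the matrix is a plain function; its columns are indexed by \<open>'v + 'd\<close>.
\<close>

definition incidence ::
  "(('v, 'd::finite) edge \<Rightarrow> ('v, 'd) triple) \<Rightarrow> ('v, 'd) edge \<Rightarrow> 'v + 'd \<Rightarrow> real" where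
  "incidence rep e c = (case rep e of (u, v, \<gamma>) \<Rightarrow>
     (case c of
        Inl w \<Rightarrow> if u = v then 0 else if w = u then - 1 else if w = v then 1 else 0
      | Inr i \<Rightarrow> real_of_int (\<gamma> $ i)))"

text \<open>The entries of the product of the transposed incidence matrix, the diagonal matrix of
  weights and the incidence matrix.\<close>

definition gain_laplacian ::
  "('v::finite, 'd::finite) edge set \<Rightarrow> (('v, 'd) edge \<Rightarrow> ('v, 'd) triple) \<Rightarrow>
   (('v, 'd) edge \<Rightarrow> real) \<Rightarrow> real^('v + 'd)^('v + 'd)" where
  "gain_laplacian E rep \<omega> =
     (\<chi> i j. \<Sum>e\<in>E. incidence rep e i * \<omega> e * incidence rep e j)"

definition pos_semidef :: "real^'n^'n \<Rightarrow> bool" where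
  "pos_semidef A \<longleftrightarrow> transpose A = A \<and> (\<forall>x. 0 \<le> x \<bullet> (A *v x))"

definition constraint_fun :: "('v::finite, 'd::finite) realization \<Rightarrow> real" where
  "constraint_fun = (\<lambda>(p, L). - ln \<bar>det L\<bar>)"

text \<open>
  Since \<open>ln 0 = 0\<close> in HOL, singular \<open>L\<close> must be excluded explicitly: there
  \<open>log \<bar>det L\<bar>\<close> is to be read as minus infinity, so the constraint fails.
\<close>

definition feasible :: "('v::finite, 'd::finite) realization \<Rightarrow> bool" where
  "feasible = (\<lambda>(p, L). det L \<noteq> 0 \<and> ln \<bar>det L\<bar> \<ge> 0)"

definition global_minimizer ::
  "('v::finite, 'd::finite) edge set \<Rightarrow> (('v, 'd) edge \<Rightarrow> ('v, 'd) triple) \<Rightarrow>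
   (('v, 'd) edge \<Rightarrow> real) \<Rightarrow> ('v, 'd) realization \<Rightarrow> bool" where
  "global_minimizer E rep \<omega> x \<longleftrightarrow>
     feasible x \<and> (\<forall>y. feasible y \<longrightarrow> energy E rep \<omega> x \<le> energy E rep \<omega> y)"

definition kkt_point ::
  "('v::finite, 'd::finite) edge set \<Rightarrow> (('v, 'd) edge \<Rightarrow> ('v, 'd) triple) \<Rightarrow>
   (('v, 'd) edge \<Rightarrow> real) \<Rightarrow> ('v, 'd) realization \<Rightarrow> bool" where
  "kkt_point E rep \<omega> x \<longleftrightarrow>
     det (snd x) \<noteq> 0 \<and>
     (\<exists>\<mu> DE Dg.
        GDERIV (energy E rep \<omega>) x :> DE \<and>
        GDERIV constraint_fun x :> Dg \<and>
        DE + \<mu> *\<^sub>R Dg = 0 \<and>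
        \<mu> * constraint_fun x = 0 \<and>
        \<mu> \<ge> 0)"

definition eq_up_to_isometry ::
  "('v::finite, 'd::finite) realization \<Rightarrow> ('v, 'd) realization \<Rightarrow> bool" where
  "eq_up_to_isometry = (\<lambda>(p, L) (p', L').
     \<exists>M x. orthogonal_matrix M \<and> (\<forall>v. p' $ v = M *v (p $ v) + x) \<and> L' = M ** L)"

end

theory Submission
  imports Defs
begin

text \<open>
  Let \<open>z\<^sub>k\<close> collect the \<open>k\<close>-th coordinates of \<open>p\<close> and the \<open>k\<close>-th row of \<open>L\<close>. The energy is
  \<open>1/2 \<Sum>\<^sub>k z\<^sub>k \<bullet> A z\<^sub>k\<close> with \<open>A\<close> the Laplacian, whose kernel consists of the translations.
  Hence the energy is coercive once a vertex is pinned and has a minimizer \<open>x\<close> on the feasible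
  set; by homogeneity \<open>x\<close> also minimizes \<open>y \<mapsto> E(y) - E(x) |det y|\<^bsup>2/d\<^esup>\<close> without constraint, and
  the vanishing gradient is the KKT condition. Conversely, stationarity in the direction that
  adds \<open>z\<^sub>i\<close> to \<open>z\<^sub>j\<close> says \<open>z\<^sub>i \<bullet> A z\<^sub>j = \<mu> \<delta>\<^sub>i\<^sub>j\<close>. For a second KKT point \<open>z'\<close> with \<open>L' = M L\<close>, the vectors
  \<open>z'\<^sub>k - \<Sum>\<^sub>j M\<^sub>k\<^sub>j z\<^sub>j\<close> lie in the kernel of \<open>A\<close>, so \<open>\<mu>' I = \<mu> M M\<^sup>T\<close>, and \<open>|det M| = 1\<close> makes \<open>M\<close>
  orthogonal.
\<close>

section \<open>Coordinate vectors and the Laplacian as energy form\<close>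

text \<open>These are the vectors \<open>z\<^sub>k\<close> of the overview, indexed like the columns
  of the incidence matrix so that the Laplacian acts on them directly.\<close>

definition coords :: "('v::finite, 'd::finite) realization \<Rightarrow> 'd \<Rightarrow> real^('v + 'd)" where
  "coords x k = (\<chi> c. case c of Inl v \<Rightarrow> fst x $ v $ k | Inr i \<Rightarrow> snd x $ k $ i)"

lemma coords_nth [simp]:
  "coords x k $ Inl v = fst x $ v $ k"
  "coords x k $ Inr i = snd x $ k $ i"
  by (simp_all add: coords_def)

lemma vec_eq_sum_iff:
  fixes x y :: "'a^('v::finite + 'd::finite)"
  shows "x = y \<longleftrightarrow> (\<forall>v. x $ Inl v = y $ Inl v) \<and> (\<forall>i. x $ Inr i = y $ Inr i)"
  by (metis vec_eq_iff sumE)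

lemma linear_coords: "linear (\<lambda>x. coords x k)"
  by (rule linearI) (simp_all add: vec_eq_sum_iff)

lemmas coords_scaleR = linear_scale[OF linear_coords]
lemmas bounded_linear_coords = linear_coords[unfolded linear_conv_bounded_linear]

lemma eq_0_if_coords_eq_0:
  assumes "\<And>k. coords x k = 0"
  shows "x = 0"
proof -
  have "fst x $ v $ k = 0" "snd x $ k $ i = 0" for v k i
    using assms[of k] by (metis coords_nth zero_index)+
  then show ?thesis
    by (simp add: prod_eq_iff vec_eq_iff)
qed

text \<open>Kept bilinear rather than quadratic: for symmetric \<open>A\<close>, the derivative of
  the energy at \<open>x\<close> in direction \<open>h\<close> is
  \<open>coord_form A h x\<close>.\<close>

definition coord_form :: "real^('v + 'd)^('v + 'd) \<Rightarrow> ('v::finite, 'd::finite) realization \<Rightarrow> ('v, 'd) realization \<Rightarrow> real"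
  where "coord_form A x y = (\<Sum>k\<in>UNIV. coords x k \<bullet> (A *v coords y k))"

lemma sum_UNIV_sum:
  fixes f :: "'v::finite + 'd::finite \<Rightarrow> real"
  shows "(\<Sum>c\<in>UNIV. f c) = (\<Sum>v\<in>UNIV. f (Inl v)) + (\<Sum>i\<in>UNIV. f (Inr i))"
  by (subst UNIV_Plus_UNIV[symmetric], subst sum.Plus) (simp_all add: o_def)

text \<open>A row of the incidence matrix computes one coordinate of the edge vector. For a loop the
  zero vertex columns agree with the cancellation of \<open>p $ v\<close> and
  \<open>p $ u\<close>.\<close>

lemma incidence_mult_coords:
  assumes "rep e = (u, v, \<gamma>)"
  shows "(\<Sum>c\<in>UNIV. incidence rep e c * coords (p, L) k $ c) = (p $ v + L *v gain_vec \<gamma> - p $ u) $ k"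
proof -
  have "(\<Sum>w\<in>UNIV. incidence rep e (Inl w) * p $ w $ k) = p $ v $ k - p $ u $ k"
  proof (cases "u = v")
    case False
    have "(\<Sum>w\<in>UNIV. incidence rep e (Inl w) * p $ w $ k)
      = (\<Sum>w\<in>UNIV. (if w = v then p $ v $ k else 0) - (if w = u then p $ u $ k else 0))"
      using False by (intro sum.cong) (auto simp: incidence_def assms)
    then show ?thesis by (simp add: sum_subtractf)
  qed (simp add: incidence_def assms)
  moreover have "(\<Sum>i\<in>UNIV. incidence rep e (Inr i) * L $ k $ i) = (L *v gain_vec \<gamma>) $ k"
    by (simp add: incidence_def assms matrix_vector_mult_def gain_vec_def mult.commute)
  ultimately show ?thesis
    by (simp add: sum_UNIV_sum)
qed

lemma inner_gain_laplacian:
  "y \<bullet> (gain_laplacian E rep \<omega> *v z) =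
    (\<Sum>e\<in>E. \<omega> e * ((\<Sum>c\<in>UNIV. incidence rep e c * y $ c) * (\<Sum>c\<in>UNIV. incidence rep e c * z $ c)))"
proof -
  let ?I = "incidence rep"
  have "y \<bullet> (gain_laplacian E rep \<omega> *v z) =
      (\<Sum>i\<in>UNIV. \<Sum>j\<in>UNIV. \<Sum>e\<in>E. \<omega> e * ((?I e i * y $ i) * (?I e j * z $ j)))"
    by (simp add: inner_vec_def matrix_vector_mult_def gain_laplacian_def sum_distrib_left
        sum_distrib_right mult_ac)
  also have "\<dots> = (\<Sum>e\<in>E. \<Sum>i\<in>UNIV. \<Sum>j\<in>UNIV. \<omega> e * ((?I e i * y $ i) * (?I e j * z $ j)))"
    by (subst sum.swap[of _ E], subst sum.swap[of _ E]) (rule refl)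
  also have "\<dots> = (\<Sum>e\<in>E. \<omega> e * ((\<Sum>i\<in>UNIV. ?I e i * y $ i) * (\<Sum>j\<in>UNIV. ?I e j * z $ j)))"
    unfolding sum_product by (simp only: sum_distrib_left)
  finally show ?thesis .
qed

text \<open>The squared norm of each edge vector splits into its coordinates, and the sums over
  edges and coordinates are exchanged.\<close>

lemma energy_eq_form:
  "energy E rep \<omega> x = 1/2 * coord_form (gain_laplacian E rep \<omega>) x x"
proof -
  obtain p L where x: "x = (p, L)" by fastforce
  have *: "(case rep e of (u, v, \<gamma>) \<Rightarrow> \<omega> e * (norm (p $ v + L *v gain_vec \<gamma> - p $ u))\<^sup>2) =
      (\<Sum>k\<in>UNIV. \<omega> e * ((\<Sum>c\<in>UNIV. incidence rep e c * coords x k $ c) *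
        (\<Sum>c\<in>UNIV. incidence rep e c * coords x k $ c)))" for e
    by (cases "rep e")
      (simp add: x incidence_mult_coords power2_norm_eq_inner inner_vec_def sum_distrib_left
        del: vector_add_component vector_minus_component)
  show ?thesis
    unfolding coord_form_def inner_gain_laplacian
    by (subst sum.swap) (simp add: energy_def x *[unfolded x])
qed

lemma form_commute:
  assumes "transpose A = A"
  shows "coord_form A x y = coord_form A y x"
  unfolding coord_form_def by (metis assms dot_lmul_matrix inner_commute transpose_matrix_vector)

lemma has_derivative_form:
  assumes "transpose A = A"
  shows "((\<lambda>y. 1/2 * coord_form A y y) has_derivative (\<lambda>h. coord_form A h x)) (at x)"
proof -
  note [derivative_intros] =
    bounded_linear.has_derivative[OF bounded_linear_coords]
    bounded_linear.has_derivative[OF matrix_vector_mul_bounded_linear]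
  have "((\<lambda>y. 1/2 * coord_form A y y) has_derivative (\<lambda>h. 1/2 * (coord_form A x h + coord_form A h x))) (at x)"
    unfolding coord_form_def
    by (auto intro!: derivative_eq_intros simp: sum.distrib algebra_simps)
  then show ?thesis
    by (simp add: form_commute[OF assms, of x])
qed

section \<open>Gradient of the constraint\<close>

text \<open>Each Leibniz term is a product of entries. Existence of a derivative suffices, because
  the directional derivatives needed later are computed along lines.\<close>

lemma has_derivative_det:
  fixes L :: "real^'n^'n"
  shows "\<exists>D. (det has_derivative D) (at L)"
proof -
  have "\<exists>D. ((\<lambda>L::real^'n^'n. of_int (sign \<sigma>) * (\<Prod>i\<in>UNIV. L $ i $ \<sigma> i)) has_derivative D) (at L)" for \<sigma>
    by (rule exI, (rule derivative_eq_intros bounded_linear_imp_has_derivative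
          bounded_linear_compose[OF bounded_linear_vec_nth] bounded_linear_vec_nth refl | simp)+)
  then have "(\<lambda>L::real^'n^'n. of_int (sign \<sigma>) * (\<Prod>i\<in>UNIV. L $ i $ \<sigma> i)) differentiable (at L)" for \<sigma>
    by (simp add: differentiable_def)
  then have "(det :: real^'n^'n \<Rightarrow> real) differentiable (at L)"
    unfolding det_def[abs_def] by (intro differentiable_sum) auto
  then show ?thesis
    by (simp add: differentiable_def)
qed

text \<open>The Riesz representation of the derivative, written in the standard basis.\<close>

lemma GDERIV_exists:
  fixes f :: "'a::euclidean_space \<Rightarrow> real"
  assumes "(f has_derivative F) (at x)"
  shows "\<exists>D. GDERIV f x :> D"
proof -
  interpret F: bounded_linear F
    using assms by (rule has_derivative_bounded_linear)
  have "F = (\<lambda>h. h \<bullet> (\<Sum>b\<in>Basis. F b *\<^sub>R b))"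
  proof
    fix h
    have "F h = F (\<Sum>b\<in>Basis. (h \<bullet> b) *\<^sub>R b)"
      by (simp add: euclidean_representation)
    then show "F h = h \<bullet> (\<Sum>b\<in>Basis. F b *\<^sub>R b)"
      by (simp add: F.sum F.scaleR inner_sum_right mult.commute)
  qed
  with assms show ?thesis
    unfolding gderiv_def by metis
qed

lemma GDERIV_constraint_fun_exists:
  fixes x :: "('v::finite, 'd::finite) realization"
  assumes "det (snd x) \<noteq> 0"
  shows "\<exists>D. GDERIV constraint_fun x :> D"
proof -
  obtain F where "(det has_derivative F) (at (snd x))"
    using has_derivative_det by blast
  then have "((\<lambda>y. det (snd y)) has_derivative (\<lambda>h. F (snd h))) (at x)"
    by (rule has_derivative_compose[OF has_derivative_snd[OF has_derivative_ident]])
  note this [derivative_intros]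
  \<comment> \<open>Squaring the determinant replaces the absolute value by a differentiable
    expression.\<close>
  have "((\<lambda>y. - (1/2) * ln ((det (snd y))\<^sup>2)) has_derivative
      (\<lambda>h. - (1/2) * (2 * det (snd x) * F (snd h) / (det (snd x))\<^sup>2))) (at x)"
    using assms
    by (auto intro!: derivative_eq_intros simp: field_simps)
  also have "(\<lambda>y :: ('v, 'd) realization. - (1/2) * ln ((det (snd y))\<^sup>2)) = constraint_fun"
  proof
    fix y :: "('v, 'd) realization"
    show "- (1/2) * ln ((det (snd y))\<^sup>2) = constraint_fun y"
      using ln_realpow[of "\<bar>det (snd y)\<bar>" 2]
      by (cases "det (snd y) = 0") (simp_all add: constraint_fun_def case_prod_beta)
  qed
  finally show ?thesis
    by (rule GDERIV_exists)
qed

lemma GDERIV_along_line: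
  assumes "GDERIV f x :> D"
  shows "((\<lambda>t. f (x + t *\<^sub>R h)) has_real_derivative h \<bullet> D) (at 0)"
proof -
  have "((\<lambda>t. x + t *\<^sub>R h) has_derivative (\<lambda>t. t *\<^sub>R h)) (at 0)"
    by (auto intro!: derivative_eq_intros)
  moreover have "(f has_derivative (\<lambda>h. h \<bullet> D)) (at (x + 0 *\<^sub>R h))"
    using assms by (simp add: gderiv_def)
  ultimately have "((\<lambda>t. f (x + t *\<^sub>R h)) has_derivative (\<lambda>t. (t *\<^sub>R h) \<bullet> D)) (at 0)"
    by (rule has_derivative_compose)
  then show ?thesis
    by (simp add: has_field_derivative_def mult.commute[of _ "h \<bullet> D"])
qed

lemma det_add_row_multiple:
  fixes L :: "real^'n^'n"
  shows "det (L + t *\<^sub>R (\<chi> a. if a = i then L $ j else 0)) = (1 + (if i = j then t else 0)) * det L"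
proof (cases "i = j")
  case True
  have "L + t *\<^sub>R (\<chi> a. if a = i then L $ j else 0) = (\<chi> a. if a = i then (1 + t) *s L $ a else L $ a)"
    using True by (simp add: vec_eq_iff algebra_simps)
  moreover have "det (\<chi> a. if a = i then L $ a else L $ a) = det L"
    by simp
  ultimately show ?thesis
    using True det_row_mul[of i "1 + t" "\<lambda>a. L $ a" "\<lambda>a. L $ a"] by simp
next
  case False
  have "L + t *\<^sub>R (\<chi> a. if a = i then L $ j else 0) =
      (\<chi> a. if a = i then row i L + t *s row j L else row a L)"
    by (simp add: vec_eq_iff row_def)
  then show ?thesis
    using det_row_operation[OF False, of L t] False by simp
qed

text \<open>Adding a multiple of row \<open>j\<close> to row \<open>i\<close> multiplies the
  determinant by a factor affine in \<open>t\<close>, so this derivative needs no cofactor formula.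
  The component \<open>q\<close> is arbitrary because the constraint ignores positions.\<close>

lemma GDERIV_constraint_fun_row:
  fixes x :: "('v::finite, 'd::finite) realization"
  assumes "det (snd x) \<noteq> 0" and "GDERIV constraint_fun x :> D"
  shows "(q, \<chi> a. if a = i then snd x $ j else 0) \<bullet> D = (if i = j then - 1 else 0)"
proof -
  let ?h = "(q, \<chi> a. if a = i then snd x $ j else 0)"
  let ?c = "if i = j then 1 else 0 :: real"
  have "((\<lambda>t. - ln \<bar>(1 + t * ?c) * det (snd x)\<bar>) has_real_derivative h \<bullet> D) (at 0)"
    if "h = ?h" for h
  proof -
    have "constraint_fun (x + t *\<^sub>R h) = - ln \<bar>(1 + t * ?c) * det (snd x)\<bar>" for t
      using det_add_row_multiple[of "snd x" t i j]
      by (auto simp: constraint_fun_def case_prod_beta that)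
    then show ?thesis
      using GDERIV_along_line[OF assms(2), of h] by simp
  qed
  then have 1: "((\<lambda>t. - ln \<bar>(1 + t * ?c) * det (snd x)\<bar>) has_real_derivative ?h \<bullet> D) (at 0)"
    by blast
  have "((\<lambda>t. - (ln (1 + t * ?c) + ln \<bar>det (snd x)\<bar>)) has_real_derivative - ?c) (at 0)"
    by (auto intro!: derivative_eq_intros)
  then have "((\<lambda>t. - ln \<bar>(1 + t * ?c) * det (snd x)\<bar>) has_real_derivative - ?c) (at 0)"
  \<comment> \<open>On this interval \<open>1 + t * ?c\<close> stays positive, so the logarithm of
    the product splits.\<close>
  proof (rule has_field_derivative_transform_within_open[where S = "{-1<..<1}"])
    show "- (ln (1 + t * ?c) + ln \<bar>det (snd x)\<bar>) = - ln \<bar>(1 + t * ?c) * det (snd x)\<bar>"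
      if "t \<in> {-1<..<1}" for t
      using that assms(1) by (auto simp: abs_mult ln_mult)
  qed auto
  from DERIV_unique[OF 1 this] show ?thesis
    by simp
qed

lemma GDERIV_constraint_fun_fst:
  fixes x :: "('v::finite, 'd::finite) realization"
  assumes "GDERIV constraint_fun x :> D"
  shows "(q, 0) \<bullet> D = 0"
proof -
  have "constraint_fun (x + t *\<^sub>R (q, 0)) = constraint_fun x" for t
    by (simp add: constraint_fun_def case_prod_beta)
  with GDERIV_along_line[OF assms, of "(q, 0)"]
  have "((\<lambda>t. constraint_fun x) has_real_derivative (q, 0) \<bullet> D) (at 0)"
    by simp
  from DERIV_unique[OF this DERIV_const] show ?thesis .
qed

lemma sum_inner_delta:
  fixes z :: "real^'n"
  shows "(\<Sum>m\<in>UNIV. (if m = k then z else 0) \<bullet> f m) = z \<bullet> f (k :: 'm::finite)"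
proof -
  have "(\<Sum>m\<in>UNIV. (if m = k then z else 0) \<bullet> f m) = (\<Sum>m\<in>UNIV. if m = k then z \<bullet> f k else 0)"
    by (intro sum.cong) auto
  then show ?thesis
    by simp
qed

section \<open>KKT conditions in coordinates\<close>

text \<open>Stationarity is tested in two families of directions: moving a single vertex, where the
  constraint is constant, and adding one coordinate vector to another, where it changes only if the
  two indices agree.\<close>

lemma kkt_point_coords:
  fixes x :: "('v::finite, 'd::finite) realization"
  assumes A: "gain_laplacian E rep \<omega> = A" and sym: "transpose A = A"
    and kkt: "kkt_point E rep \<omega> x"
  obtains \<mu> where "det (snd x) \<noteq> 0" "\<mu> * constraint_fun x = 0"
    "\<And>k v. (A *v coords x k) $ Inl v = 0"
    "\<And>i j. coords x i \<bullet> (A *v coords x j) = (if i = j then \<mu> else 0)"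
proof -
  obtain \<mu> DE Dg where det: "det (snd x) \<noteq> 0" and DE: "GDERIV (energy E rep \<omega>) x :> DE"
    and Dg: "GDERIV constraint_fun x :> Dg" and stat: "DE + \<mu> *\<^sub>R Dg = 0"
    and slack: "\<mu> * constraint_fun x = 0"
    using kkt unfolding kkt_point_def by blast
  have "(energy E rep \<omega> has_derivative (\<lambda>h. coord_form A h x)) (at x)"
    using has_derivative_form[OF sym, of x] by (simp add: energy_eq_form[abs_def] A)
  from has_derivative_unique[OF DE[unfolded gderiv_def] this]
  have coord_form: "coord_form A h x = - \<mu> * (h \<bullet> Dg)" for h
    using stat by (metis add_eq_0_iff2 inner_minus_right inner_scaleR_right mult_minus_left)
  have "(A *v coords x k) $ Inl v = 0" for k v
  proof -
    let ?h = "(axis v (axis k 1), 0) :: ('v, 'd) realization"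
    have "coords ?h m = (if m = k then axis (Inl v) 1 else 0)" for m
      by (auto simp: vec_eq_sum_iff axis_def)
    then have "coord_form A ?h x = (A *v coords x k) $ Inl v"
      by (simp add: coord_form_def sum_inner_delta inner_axis')
    then show ?thesis
      using coord_form[of ?h] GDERIV_constraint_fun_fst[OF Dg] by simp
  qed
  moreover have "coords x i \<bullet> (A *v coords x j) = (if i = j then \<mu> else 0)" for i j
  proof -
    \<comment> \<open>This direction has \<open>coords x i\<close> as its \<open>j\<close>-th
      coordinate vector and zero for all others.\<close>
    let ?h = "(\<chi> v. axis j (fst x $ v $ i), \<chi> a. if a = j then snd x $ i else 0) :: ('v, 'd) realization"
    have "coords ?h m = (if m = j then coords x i else 0)" for m
      by (auto simp: vec_eq_sum_iff axis_def)
    then have "coord_form A ?h x = coords x i \<bullet> (A *v coords x j)"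
      by (simp add: coord_form_def sum_inner_delta)
    then show ?thesis
      using coord_form[of ?h] GDERIV_constraint_fun_row[OF det Dg, of _ j i] by auto
  qed
  ultimately show ?thesis
    using that det slack by blast
qed

section \<open>Kernel of a positive semidefinite Laplacian\<close>

text \<open>Along \<open>z + t *\<^sub>R (A *v z)\<close> the quadratic form is
  \<open>2 * t * a + t\<^sup>2 * b\<close>. If \<open>a\<close> were positive, this would be
  negative for small negative \<open>t\<close>.\<close>

lemma psd_inner_eq_0:
  fixes A :: "real^'n^'n"
  assumes "pos_semidef A" and "z \<bullet> (A *v z) = 0"
  shows "A *v z = 0"
proof -
  define w a b where "w = A *v z" and "a = w \<bullet> w" and "b = w \<bullet> (A *v w)"
  have nonneg: "0 \<le> y \<bullet> (A *v y)" for y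
    using assms(1) by (simp add: pos_semidef_def)
  have "z \<bullet> (A *v w) = a"
    using assms(1) unfolding pos_semidef_def a_def w_def
    by (metis dot_lmul_matrix transpose_matrix_vector)
  then have expand: "(z + t *\<^sub>R w) \<bullet> (A *v (z + t *\<^sub>R w)) = 2 * t * a + t\<^sup>2 * b" for t
    using assms(2)
    by (simp add: matrix_vector_right_distrib matrix_vector_mult_scaleR inner_add_left
        inner_add_right a_def b_def power2_eq_square algebra_simps flip: w_def)
  have "b \<ge> 0"
    unfolding b_def by (rule nonneg)
  \<comment> \<open>Dividing by \<open>b + 1\<close> instead of \<open>b\<close> also covers
    \<open>b = 0\<close>; the quadratic then becomes \<open>- (t\<^sup>2 * (b + 2))\<close>.\<close>
  define t where "t = - a / (b + 1)"
  have a: "a = - t * (b + 1)"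
    using \<open>b \<ge> 0\<close> by (simp add: t_def)
  have "0 \<le> 2 * t * a + t\<^sup>2 * b"
    using nonneg expand by metis
  also have "\<dots> = - (t\<^sup>2 * (b + 2))"
    by (simp add: a power2_eq_square algebra_simps)
  finally have "t = 0"
    using \<open>b \<ge> 0\<close> by (auto simp: mult_le_0_iff)
  then have "a = 0"
    by (simp add: a)
  then show ?thesis
    by (simp add: a_def w_def)
qed

text \<open>The coordinate vector of a unit translation: all vertices move together and the matrix
  part is zero.\<close>

definition vertex_ones :: "real^('v::finite + 'd::finite)" where
  "vertex_ones = (\<chi> c. case c of Inl v \<Rightarrow> 1 | Inr i \<Rightarrow> 0)"

lemma vertex_ones_nth [simp]: "vertex_ones $ Inl v = 1" "vertex_ones $ Inr i = 0"
  by (simp_all add: vertex_ones_def)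

lemma gain_laplacian_vertex_ones:
  fixes rep :: "('v::finite, 'd::finite) edge \<Rightarrow> ('v, 'd) triple"
  shows "gain_laplacian E rep \<omega> *v vertex_ones = 0"
proof -
  have "(\<Sum>c\<in>UNIV. incidence rep e c * vertex_ones $ c) = 0" for e
  proof -
    \<comment> \<open>Any coordinate serves: placing every vertex at \<open>axis k 1\<close> with
      zero matrix makes all edge vectors vanish.\<close>
    fix k :: 'd
    obtain u v \<gamma> where rep: "rep e = (u, v, \<gamma>)"
      by (metis prod.exhaust)
    have "vertex_ones = coords (\<chi> v::'v. axis k 1, 0) k"
      by (simp add: vec_eq_sum_iff)
    then show ?thesis
      using incidence_mult_coords[of rep e u v \<gamma> "\<chi> v. axis k 1" 0 k] rep by simp
  qed
  then have "y \<bullet> (gain_laplacian E rep \<omega> *v vertex_ones) = 0" for y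
    by (simp add: inner_gain_laplacian)
  then show ?thesis
    by (metis inner_eq_zero_iff)
qed

text \<open>The kernel contains the nonzero vector \<open>vertex_ones\<close>, so dimension one
  leaves room for nothing beyond its span.\<close>

lemma gain_laplacian_kernel:
  assumes "dim {x. gain_laplacian E rep \<omega> *v x = 0} = 1" and "gain_laplacian E rep \<omega> *v z = 0"
  obtains c where "z = c *\<^sub>R vertex_ones"
proof -
  have "vertex_ones \<noteq> (0 :: real^('a + 'b))"
    by (simp add: vec_eq_sum_iff)
  then have "{x. gain_laplacian E rep \<omega> *v x = 0} \<subseteq> span {vertex_ones}"
    using assms(1) by (intro card_ge_dim_independent) (auto simp: gain_laplacian_vertex_ones)
  then show ?thesis
    using assms(2) that by (auto simp: span_singleton)
qed

lemma det_scaleR: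
  fixes L :: "real^'n^'n"
  shows "det (c *\<^sub>R L) = c ^ CARD('n) * det L"
proof -
  have "c *\<^sub>R L = (\<chi> i. c *s (L $ i))"
    by (simp add: vec_eq_iff)
  then show ?thesis
    using det_rows_mul[of "\<lambda>_. c" "\<lambda>i. L $ i"] by simp
qed

lemma det_zero_matrix: "det (0 :: real^'n^'n) = 0"
  using det_scaleR[of 0 "0 :: real^'n^'n"] by (simp add: power_0_left)

lemma form_scaleR: "coord_form A (c *\<^sub>R x) (c *\<^sub>R x) = c\<^sup>2 * coord_form A x x"
  by (simp add: coord_form_def coords_scaleR matrix_vector_mult_scaleR power2_eq_square sum_distrib_left mult.assoc)

section \<open>Positivity of the form modulo translations\<close>

text \<open>From here on the graph enters only through these two properties of its
  Laplacian.\<close>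

locale definite_modulo_translations =
  fixes A :: "real^('v::finite + 'd::finite)^('v + 'd)"
  assumes psd: "pos_semidef A"
    and kernel_iff: "A *v z = 0 \<longleftrightarrow> (\<exists>c. z = c *\<^sub>R vertex_ones)"
begin

lemma sym: "transpose A = A"
  using psd by (simp add: pos_semidef_def)

lemma inner_nonneg: "0 \<le> z \<bullet> (A *v z)"
  using psd by (simp add: pos_semidef_def)

lemma form_nonneg: "0 \<le> coord_form A x x"
  unfolding coord_form_def by (intro sum_nonneg inner_nonneg)

lemma form_eq_0:
  assumes "coord_form A x x = 0"
  obtains c where "\<And>k. coords x k = c k *\<^sub>R vertex_ones"
proof -
  have "coords x k \<bullet> (A *v coords x k) = 0" for k
    using assms unfolding coord_form_def by (subst (asm) sum_nonneg_eq_0_iff) (auto simp: inner_nonneg)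
  then have "\<exists>c. coords x k = c *\<^sub>R vertex_ones" for k
    using psd_inner_eq_0[OF psd] kernel_iff by blast
  then show ?thesis
    using that by metis
qed

text \<open>If the form vanished, all coordinate vectors would be multiples of
  \<open>vertex_ones\<close>, whose matrix entries are zero, so the matrix would be zero and hence
  singular.\<close>

lemma form_pos:
  assumes "det (snd x) \<noteq> 0"
  shows "0 < coord_form A x x"
proof (rule ccontr)
  assume "\<not> ?thesis"
  then have "coord_form A x x = 0"
    using form_nonneg[of x] by linarith
  then obtain c where "\<And>k. coords x k = c k *\<^sub>R vertex_ones"
    using form_eq_0 by blast
  then have "snd x $ k $ i = 0" for k i
    using coords_nth(2)[of x k i] by simp
  then have "snd x = 0"
    by (simp add: vec_eq_iff)
  then show False
    using assms by (simp add: det_zero_matrix)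
qed

lemma form_translate: "coord_form A (\<chi> v. fst x $ v - q, snd x) (\<chi> v. fst x $ v - q, snd x) = coord_form A x x"
proof -
  have "coords (\<chi> v. fst x $ v - q, snd x) k = coords x k - (q $ k) *\<^sub>R vertex_ones" for k
    by (simp add: vec_eq_sum_iff)
  moreover have "A *v vertex_ones = 0"
    using kernel_iff[of vertex_ones] by (metis scaleR_one)
  moreover from this have "vertex_ones \<bullet> (A *v z) = 0" for z
    by (metis dot_lmul_matrix inner_zero_left sym transpose_matrix_vector)
  ultimately show ?thesis
    by (simp add: coord_form_def matrix_vector_mult_diff_distrib matrix_vector_mult_scaleR inner_diff_left)
qed

lemma continuous_on_form: "continuous_on S (\<lambda>x. coord_form A x x)"
proof -
  have "continuous (at x) (\<lambda>x. 2 * (1/2 * coord_form A x x))" for x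
    by (rule continuous_mult_left[OF has_derivative_continuous[OF has_derivative_form[OF sym]]])
  then show ?thesis
    by (simp add: continuous_at_imp_continuous_on)
qed

section \<open>Existence of a minimizer\<close>

text \<open>Pinning a vertex excludes the translations, so the form has a positive minimum on the
  compact unit sphere of the pinned subspace; homogeneity extends the bound to all pinned
  realizations.\<close>

lemma form_coercive:
  fixes v\<^sub>0 :: 'v
  obtains m where "0 < m" and "\<And>x. fst x $ v\<^sub>0 = 0 \<Longrightarrow> m * (norm x)\<^sup>2 \<le> coord_form A x x"
proof -
  let ?S = "sphere 0 1 \<inter> {x :: ('v, 'd) realization. fst x $ v\<^sub>0 = 0}"
  have normalize: "(1 / norm x) *\<^sub>R x \<in> ?S" if "fst x $ v\<^sub>0 = 0" "x \<noteq> 0" for x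
    using that by simp
  have "compact ?S"
    by (intro compact_Int_closed closed_Collect_eq continuous_intros) auto
  moreover have "?S \<noteq> {}"
  proof -
    have "mat 1 \<noteq> (0 :: real^'d^'d)"
      using det_I det_zero_matrix by (metis zero_neq_one)
    then have "(0, mat 1) \<noteq> (0 :: ('v, 'd) realization)"
      by (simp add: zero_prod_def)
    then show ?thesis
      using normalize[of "(0, mat 1)"] by (metis empty_iff fst_conv zero_index)
  qed
  ultimately have "\<exists>y\<in>?S. \<forall>x\<in>?S. coord_form A y y \<le> coord_form A x x"
    by (rule continuous_attains_inf[OF _ _ continuous_on_form])
  then obtain y where y: "y \<in> ?S" "\<forall>x\<in>?S. coord_form A y y \<le> coord_form A x x"
    by (rule bexE)
  have "coord_form A y y \<noteq> 0"
  proof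
    assume "coord_form A y y = 0"
    then obtain c where c: "\<And>k. coords y k = c k *\<^sub>R vertex_ones"
      using form_eq_0 by blast
    \<comment> \<open>The entry at the pinned vertex is both \<open>0\<close> and
      \<open>c k\<close>.\<close>
    have "c k = 0" for k
      using y(1) coords_nth(1)[of y k v\<^sub>0] by (simp add: c)
    with c have "y = 0"
      by (intro eq_0_if_coords_eq_0) simp
    with y(1) show False
      by simp
  qed
  then have "0 < coord_form A y y"
    using form_nonneg[of y] by linarith
  moreover have "coord_form A y y * (norm x)\<^sup>2 \<le> coord_form A x x" if "fst x $ v\<^sub>0 = 0" for x
  proof (cases "x = 0")
    case True
    then show ?thesis
      by (simp add: form_nonneg)
  next
    case False
    with bspec[OF y(2) normalize[OF that False]] show ?thesis
      by (simp add: form_scaleR power_divide field_simps)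
  qed
  ultimately show ?thesis
    using that by blast
qed

lemma form_minimizer:
  obtains x where "1 \<le> \<bar>det (snd x)\<bar>" "\<And>y. 1 \<le> \<bar>det (snd y)\<bar> \<Longrightarrow> coord_form A x x \<le> coord_form A y y"
proof -
  fix v\<^sub>0 :: 'v
  let ?I = "(0, mat 1) :: ('v, 'd) realization"
  \<comment> \<open>The pinned realizations doing at least as well as the competitor
    \<open>?I\<close>; coercivity makes this set compact.\<close>
  let ?K = "{x. fst x $ v\<^sub>0 = 0 \<and> 1 \<le> \<bar>det (snd x)\<bar> \<and> coord_form A x x \<le> coord_form A ?I ?I}"
  obtain m where m: "0 < m" "\<And>x. fst x $ v\<^sub>0 = 0 \<Longrightarrow> m * (norm x)\<^sup>2 \<le> coord_form A x x"
    using form_coercive by blast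
  have "continuous_on UNIV (\<lambda>x :: ('v, 'd) realization. det (snd x))"
    unfolding det_def by (intro continuous_intros)
  then have "closed ?K"
    by (intro closed_Collect_conj closed_Collect_eq closed_Collect_le continuous_intros continuous_on_form)
  moreover have "bounded ?K"
    unfolding bounded_iff
  proof (intro exI ballI)
    fix x assume "x \<in> ?K"
    then have "(norm x)\<^sup>2 \<le> coord_form A ?I ?I / m"
      using m(1) m(2)[of x] by (simp add: field_simps)
    then show "norm x \<le> sqrt (coord_form A ?I ?I / m)"
      by (rule real_le_rsqrt)
  qed
  moreover have "?I \<in> ?K"
    by simp
  ultimately have "compact ?K" "?K \<noteq> {}"
    using compact_eq_bounded_closed by blast+
  then have "\<exists>x\<in>?K. \<forall>y\<in>?K. coord_form A x x \<le> coord_form A y y"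
    by (rule continuous_attains_inf[OF _ _ continuous_on_form])
  then obtain x where x: "x \<in> ?K" "\<forall>y\<in>?K. coord_form A x x \<le> coord_form A y y"
    by (rule bexE)
  have "coord_form A x x \<le> coord_form A y y" if "1 \<le> \<bar>det (snd y)\<bar>" for y
  proof -
    \<comment> \<open>Translating \<open>y\<close> pins it without changing the form. If the result
      lies outside \<open>?K\<close>, then \<open>?I\<close>, and hence \<open>x\<close>, already
      does better.\<close>
    let ?y = "(\<chi> v. fst y $ v - fst y $ v\<^sub>0, snd y)"
    show ?thesis
    proof (cases "coord_form A ?y ?y \<le> coord_form A ?I ?I")
      case True
      then have "?y \<in> ?K"
        using that by simp
      from bspec[OF x(2) this] show ?thesis
        by (simp add: form_translate)
    next
      case False
      then show ?thesis
        using x(1) by (simp add: form_translate)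
    qed
  qed
  with x(1) show ?thesis
    using that by blast
qed

text \<open>The exponential is \<open>\<bar>det (snd y)\<bar>\<close> to the power
  \<open>2/d\<close>. Scaling \<open>y\<close> to determinant of absolute value one turns the
  constrained minimum into a bound for all nonsingular matrices.\<close>

lemma form_minimizer_rescaled:
  assumes x: "1 \<le> \<bar>det (snd x)\<bar>" "\<And>y. 1 \<le> \<bar>det (snd y)\<bar> \<Longrightarrow> coord_form A x x \<le> coord_form A y y"
    and det: "det (snd y) \<noteq> 0"
  shows "coord_form A x x * exp (- (2 / CARD('d)) * constraint_fun y) \<le> coord_form A y y"
proof -
  define c where "c = exp (constraint_fun y / CARD('d))"
  have "c ^ CARD('d) = exp (constraint_fun y)"
    by (simp add: c_def flip: exp_of_nat_mult)
  then have "\<bar>det (snd (c *\<^sub>R y))\<bar> = 1"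
    using det by (simp add: det_scaleR abs_mult constraint_fun_def case_prod_beta exp_minus)
  then have "coord_form A x x \<le> c\<^sup>2 * coord_form A y y"
    using x(2)[of "c *\<^sub>R y"] by (simp add: form_scaleR)
  then have "coord_form A x x * exp (- (2 / CARD('d)) * constraint_fun y) \<le>
      c\<^sup>2 * coord_form A y y * exp (- (2 / CARD('d)) * constraint_fun y)"
    by (rule mult_right_mono) simp
  also have "c\<^sup>2 * exp (- (2 / CARD('d)) * constraint_fun y) = 1"
    by (simp add: c_def power2_eq_square flip: exp_add)
  then have "c\<^sup>2 * coord_form A y y * exp (- (2 / CARD('d)) * constraint_fun y) = coord_form A y y"
    by (simp add: mult.commute mult.left_commute)
  finally show ?thesis .
qed

section \<open>Uniqueness up to isometry\<close>

lemma isometric_if_critical: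
  assumes x: "det (snd x) \<noteq> 0" "\<mu> * constraint_fun x = 0"
      "\<And>k v. (A *v coords x k) $ Inl v = 0"
      "\<And>i j. coords x i \<bullet> (A *v coords x j) = (if i = j then \<mu> else 0)"
    and y: "det (snd y) \<noteq> 0" "\<nu> * constraint_fun y = 0"
      "\<And>k v. (A *v coords y k) $ Inl v = 0"
      "\<And>i j. coords y i \<bullet> (A *v coords y j) = (if i = j then \<nu> else 0)"
  shows "eq_up_to_isometry x y"
proof -
  \<comment> \<open>Summing the diagonal relations makes both multipliers positive, so complementary
    slackness forces both determinants to absolute value one.\<close>
  have "coord_form A x x = CARD('d) * \<mu>" "coord_form A y y = CARD('d) * \<nu>"
    by (simp_all add: coord_form_def x(4) y(4))
  then have pos: "0 < \<mu>" "0 < \<nu>"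
    using form_pos[OF x(1)] form_pos[OF y(1)] by (simp_all add: zero_less_mult_iff)
  then have abs_det: "\<bar>det (snd x)\<bar> = 1" "\<bar>det (snd y)\<bar> = 1"
    using x(1,2) y(1,2) by (auto simp: constraint_fun_def case_prod_beta)
  obtain N where N: "N ** snd x = mat 1"
    using x(1) by (auto simp flip: invertible_det_nz simp: invertible_def)
  define M where "M = snd y ** N"
  have M: "M ** snd x = snd y"
    by (simp add: M_def N flip: matrix_mul_assoc)
  have M_nth: "snd y $ k $ i = (\<Sum>j\<in>UNIV. M $ k $ j * snd x $ j $ i)" for k i
    by (simp add: matrix_matrix_mult_def flip: M)
  have abs_det_M: "\<bar>det M\<bar> = 1"
    using abs_det det_mul[of M "snd x"] by (simp add: M abs_mult)
  \<comment> \<open>The matrix entries of \<open>w k\<close> vanish because \<open>M\<close> maps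
    one matrix to the other, while the vertex entries of \<open>A *v w k\<close> vanish by
    stationarity. The two supports are disjoint, so the inner product is zero.\<close>
  define w where "w k = coords y k - (\<Sum>j\<in>UNIV. M $ k $ j *\<^sub>R coords x j)" for k
  have A_w: "A *v w k = A *v coords y k - (\<Sum>j\<in>UNIV. M $ k $ j *\<^sub>R (A *v coords x j))" for k
    by (simp add: w_def matrix_vector_mult_diff_distrib linear_sum[OF matrix_vector_mul_linear]
        matrix_vector_mult_scaleR)
  have "w k \<bullet> (A *v w k) = 0" for k
  proof -
    have "w k $ Inr i = 0" for i
      by (simp add: w_def M_nth)
    moreover have "(A *v w k) $ Inl v = 0" for v
      by (simp add: A_w x(3) y(3))
    ultimately show ?thesis
      by (simp add: inner_vec_def sum_UNIV_sum)
  qed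
  then have A_w_0: "A *v w k = 0" for k
    by (rule psd_inner_eq_0[OF psd])
  then have "\<forall>k. \<exists>c. w k = c *\<^sub>R vertex_ones"
    by (simp flip: kernel_iff)
  from choice[OF this] obtain c where c: "\<forall>k. w k = c k *\<^sub>R vertex_ones" ..
  have "fst y $ v = M *v (fst x $ v) + (\<chi> k. c k)" for v
  proof -
    have "c k = fst y $ v $ k - (\<Sum>j\<in>UNIV. M $ k $ j * fst x $ v $ j)" for k
    proof -
      have "w k $ Inl v = c k"
        by (simp add: c)
      then show ?thesis
        by (simp add: w_def)
    qed
    then show ?thesis
      by (simp add: vec_eq_iff matrix_vector_mult_def)
  qed
  moreover have "orthogonal_matrix M"
  proof -
    have "(M ** transpose M) $ i $ k = (if i = k then \<nu> / \<mu> else 0)" for i k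
    proof -
      have "w i \<bullet> (A *v z) = 0" for z
        using A_w_0[of i] by (metis dot_lmul_matrix inner_zero_left sym transpose_matrix_vector)
      \<comment> \<open>Modulo the kernel of \<open>A\<close>, \<open>coords y i\<close> is the
        combination of the \<open>coords x a\<close> with coefficients from row \<open>i\<close> of
        \<open>M\<close>; inserting this in both arguments gives
        \<open>\<nu> I = \<mu> M M\<^sup>T\<close>.\<close>
      then have "coords y i \<bullet> (A *v z) = (\<Sum>a\<in>UNIV. M $ i $ a * (coords x a \<bullet> (A *v z)))" for z
        by (simp add: w_def inner_diff_left inner_sum_left)
      moreover have "A *v coords y k = (\<Sum>b\<in>UNIV. M $ k $ b *\<^sub>R (A *v coords x b))"
        using A_w[of k] A_w_0[of k] by simp
      then have "coords x a \<bullet> (A *v coords y k) = M $ k $ a * \<mu>" for a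
        by (simp add: inner_sum_right x(4) if_distrib[of "(*) _"] cong: if_cong)
      ultimately have "(if i = k then \<nu> else 0) = (\<Sum>a\<in>UNIV. M $ i $ a * (M $ k $ a * \<mu>))"
        using y(4)[of i k] by simp
      also have "\<dots> = \<mu> * (M ** transpose M) $ i $ k"
        by (simp add: matrix_matrix_mult_def transpose_def sum_distrib_left mult_ac)
      finally show ?thesis
        using pos by (auto simp: field_simps split: if_splits)
    qed
    then have MM: "M ** transpose M = (\<nu> / \<mu>) *\<^sub>R mat 1"
      by (simp add: vec_eq_iff mat_def)
    \<comment> \<open>Comparing determinants identifies the scalar: its \<open>d\<close>-th power is
      one and it is positive.\<close>
    have "(\<nu> / \<mu>) ^ CARD('d) = (det M)\<^sup>2"
      using arg_cong[OF MM, of det] by (simp add: det_scaleR det_mul power2_eq_square)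
    also have "\<dots> = 1"
      using abs_det_M by (metis power2_abs one_power2)
    finally have "\<nu> / \<mu> = 1"
      using pos by (intro power_eq_imp_eq_base[of _ "CARD('d)" 1]) auto
    with MM show ?thesis
      by (simp add: orthogonal_matrix_def matrix_left_right_inverse)
  qed
  ultimately show ?thesis
    using M by (auto simp: eq_up_to_isometry_def case_prod_beta)
qed

end

section \<open>Existence and uniqueness of KKT points for gain graphs\<close>

theorem theorem8p5:
  fixes E :: "('v::finite, 'd::finite) edge set"
    and rep :: "('v, 'd) edge \<Rightarrow> ('v, 'd) triple"
    and \<omega> :: "('v, 'd) edge \<Rightarrow> real"
  assumes "gain_graph E"
    and "edge_reps E rep"
    and "dim {x. gain_laplacian E rep \<omega> *v x = 0} = 1"
    and "pos_semidef (gain_laplacian E rep \<omega>)"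
  shows "(\<exists>x. kkt_point E rep \<omega> x \<and> global_minimizer E rep \<omega> x) \<and>
         (\<forall>x y. kkt_point E rep \<omega> x \<longrightarrow> kkt_point E rep \<omega> y \<longrightarrow> eq_up_to_isometry x y)"
proof (intro conjI allI impI)
  define A where "A = gain_laplacian E rep \<omega>"
  interpret definite_modulo_translations A
  proof
    fix z
    show "A *v z = 0 \<longleftrightarrow> (\<exists>c. z = c *\<^sub>R vertex_ones)"
      using gain_laplacian_kernel[OF assms(3)]
      by (metis A_def gain_laplacian_vertex_ones matrix_vector_mult_scaleR scaleR_zero_right)
  qed (simp add: A_def assms(4))
  have energy: "energy E rep \<omega> x = 1/2 * coord_form A x x" for x
    by (simp add: energy_eq_form A_def)
  have feasible: "feasible x \<longleftrightarrow> 1 \<le> \<bar>det (snd x)\<bar>" for x :: "('v, 'd) realization"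
    by (cases "det (snd x) = 0") (auto simp: feasible_def case_prod_beta)

  show "eq_up_to_isometry x y" if x: "kkt_point E rep \<omega> x" and y: "kkt_point E rep \<omega> y" for x y
  proof -
    obtain \<mu> where \<mu>: "det (snd x) \<noteq> 0" "\<mu> * constraint_fun x = 0"
      "\<And>k v. (A *v coords x k) $ Inl v = 0"
      "\<And>i j. coords x i \<bullet> (A *v coords x j) = (if i = j then \<mu> else 0)"
      using kkt_point_coords[OF A_def[symmetric] sym x] by blast
    obtain \<nu> where \<nu>: "det (snd y) \<noteq> 0" "\<nu> * constraint_fun y = 0"
      "\<And>k v. (A *v coords y k) $ Inl v = 0"
      "\<And>i j. coords y i \<bullet> (A *v coords y j) = (if i = j then \<nu> else 0)"
      using kkt_point_coords[OF A_def[symmetric] sym y] by blast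
    show ?thesis
      by (rule isometric_if_critical[OF \<mu> \<nu>])
  qed

  show "\<exists>x. kkt_point E rep \<omega> x \<and> global_minimizer E rep \<omega> x"
  proof -
    obtain x where x: "1 \<le> \<bar>det (snd x)\<bar>" "\<And>y. 1 \<le> \<bar>det (snd y)\<bar> \<Longrightarrow> coord_form A x x \<le> coord_form A y y"
      using form_minimizer by blast
    then have det: "det (snd x) \<noteq> 0"
      by auto
    let ?a = "coord_form A x x" and ?r = "2 / real CARD('d)"
    have "0 < ?a"
      using form_pos[OF det] .
    have rescaled: "?a * exp (- ?r * constraint_fun y) \<le> coord_form A y y" if "det (snd y) \<noteq> 0" for y
      using form_minimizer_rescaled[OF x that] .
    have "constraint_fun x \<le> 0"
      using x(1) by (simp add: constraint_fun_def case_prod_beta)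
    \<comment> \<open>The rescaled inequality at \<open>y = x\<close> bounds the exponential by one,
      so the constraint is active.\<close>
    moreover have "0 \<le> constraint_fun x"
      using rescaled[OF det] \<open>0 < ?a\<close> by (simp add: mult_le_cancel_left1 zero_le_divide_iff zero_le_mult_iff)
    ultimately have g: "constraint_fun x = 0"
      by simp
    have E: "(energy E rep \<omega> has_derivative (\<lambda>h. coord_form A h x)) (at x)"
      using has_derivative_form[OF sym] by (simp add: energy[abs_def])
    obtain DE where DE: "GDERIV (energy E rep \<omega>) x :> DE"
      using GDERIV_exists[OF E] by blast
    obtain Dg where Dg: "GDERIV constraint_fun x :> Dg"
      using GDERIV_constraint_fun_exists[OF det] by blast
    \<comment> \<open>On the open set of nonsingular matrices this function is nonnegative and it
      vanishes at \<open>x\<close>, so its derivative there is zero. Differentiating the exponential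
      at \<open>constraint_fun x = 0\<close> produces the multiplier \<open>?a / d\<close>.\<close>
    let ?\<Phi> = "\<lambda>y. energy E rep \<omega> y - 1/2 * ?a * exp (- ?r * constraint_fun y)"
    note [derivative_intros] = DE[unfolded gderiv_def] Dg[unfolded gderiv_def]
    have "(?\<Phi> has_derivative (\<lambda>h. h \<bullet> DE + 1/2 * ?a * ?r * (h \<bullet> Dg))) (at x)"
      by (auto intro!: derivative_eq_intros simp: g)
    moreover have "open {y :: ('v, 'd) realization. det (snd y) \<noteq> 0}"
      unfolding det_def by (intro open_Collect_neq continuous_intros)
    ultimately have "(\<lambda>h. h \<bullet> DE + 1/2 * ?a * ?r * (h \<bullet> Dg)) = (\<lambda>h. 0)"
      using det rescaled
      by (intro differential_zero_maxmin[where x = x and f = ?\<Phi> and S = "{y. det (snd y) \<noteq> 0}"])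
        (auto simp: energy g)
    then have "h \<bullet> (DE + (1/2 * ?a * ?r) *\<^sub>R Dg) = 0" for h
      unfolding inner_add_right inner_scaleR_right by (rule fun_cong)
    then have "DE + (1/2 * ?a * ?r) *\<^sub>R Dg = 0"
      by (metis inner_eq_zero_iff)
    moreover have "0 \<le> 1/2 * ?a * ?r"
      using \<open>0 < ?a\<close> by simp
    ultimately have "kkt_point E rep \<omega> x"
      unfolding kkt_point_def using det DE Dg g by (metis mult_zero_right)
    moreover have "global_minimizer E rep \<omega> x"
      using x by (simp add: global_minimizer_def feasible energy)
    ultimately show ?thesis
      by blast
  qed
qed

end
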